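(* Let $n,q$ be positive integers, let $A$ be a $q\times q$ integer matrix and let $l_1,\dots,l_q$ be integers such that each row $A_j$ of $A$ satisfies $A_j=[l_1,\dots,l_q] \mod n$ (entrywise congruence). Let $f_{n,A}:T^q\to D_n(T^q)$ be the linear $n$-valued torus map induced by $A$. Then $f_{n,A}$ has a nontrivial partition if and only if there is some $m\in\mathbb{Z}$ with $m>1$ which is a common factor of $n$ and every $l_j$. In this case, for such an $m$, $f_{n,A}$ partitions into a set of $m$ maps, each homotopic to the linear $\frac nm$-valued map $f_{\frac nm,\frac 1m A}$.
   Context: For a space $Y$, $D_n(Y)$ is the space of unordered $n$-element subsets of $Y$, topologized as the quotient by $\Sigma_n$ of $F_n(Y)=\{(y_1,\dots,y_n)\in Y^n\mid y_i\ne y_j\text{ for } i\neq j\}$ (subspace topology). An $n$-valued map $X\to Y$ is a continuous function $f:X\to D_n(Y)$; a homotopy of $n$-valued maps is a continuous map $X\times[0,1]\to D_n(Y)$. A partition of $f$ is a set $\{f_1,\dots,f_s\}$ of $k_i$-valued maps $f_i:X\to D_{k_i}(Y)$ with positive integers $k_1+\dots+k_s=n$ and $f(x)=f_1(x)\cup\dots\cup f_s(x)$ for every $x$; it is nontrivial if $s\geq 2$, and in this situation $f$ is said to partition into the maps $f_1,\dots,f_s$. Let $T^q=\mathbb{R}^q/\mathbb{Z}^q$ with universal covering $p^q:\mathbb{R}^q\to T^q$, and let $\mathbf c\in\mathbb{R}^q$ be the vector all of whose coordinates equal $1$. For a $q\times q$ integer matrix $A$ and an integer $k$ let $f^k_{n,A}:\mathbb{R}^q\to\mathbb{R}^q$,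 $f^k_{n,A}(t)=\frac1n(At+k\mathbf c)$. When all rows of $A$ are congruent to one another modulo $n$, the formula $f_{n,A}(p^q(t))=p^q\{f^1_{n,A}(t),\dots,f^n_{n,A}(t)\}$ gives a well-defined $n$-valued map $f_{n,A}:T^q\to D_n(T^q)$, called the linear $n$-valued map induced by $A$. *)

theory Defs
  imports "HOL-Analysis.Analysis" "HOL-Number_Theory.Cong"
begin

section \<open>Quotient topology\<close>

definition quotient_topology :: "'a topology \<Rightarrow> ('a \<Rightarrow> 'b) \<Rightarrow> 'b topology" where
  "quotient_topology X f =
     topology (\<lambda>U. U \<subseteq> f ` topspace X \<and> openin X {x \<in> topspace X. f x \<in> U})"

lemma openin_quotient_topology:
  "openin (quotient_topology X f) U \<longleftrightarrow>
     U \<subseteq> f ` topspace X \<and> openin X {x \<in> topspace X. f x \<in> U}"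
proof -
  let ?P = "\<lambda>U. U \<subseteq> f ` topspace X \<and> openin X {x \<in> topspace X. f x \<in> U}"
  have "istopology ?P"
    unfolding istopology_def
  proof (intro conjI allI impI)
    fix S T assume S: "?P S" and T: "?P T"
    show "S \<inter> T \<subseteq> f ` topspace X" using S by blast
    have "{x \<in> topspace X. f x \<in> S \<inter> T} =
          {x \<in> topspace X. f x \<in> S} \<inter> {x \<in> topspace X. f x \<in> T}" by blast
    then show "openin X {x \<in> topspace X. f x \<in> S \<inter> T}" using S T by auto
  next
    fix K assume K: "\<forall>S\<in>K. ?P S"
    then show "\<Union>K \<subseteq> f ` topspace X" by blast
    have "{x \<in> topspace X. f x \<in> \<Union>K} = (\<Union>S\<in>K. {x \<in> topspace X. f x \<in> S})" by blast
    then show "openin X {x \<in> topspace X. f x \<in> \<Union>K}" using K by auto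
  qed
  then show ?thesis unfolding quotient_topology_def by (simp add: topology_inverse')
qed

lemma topspace_quotient_topology [simp]:
  "topspace (quotient_topology X f) = f ` topspace X"
proof (rule subset_antisym)
  show "topspace (quotient_topology X f) \<subseteq> f ` topspace X"
    using openin_topspace[of "quotient_topology X f"] unfolding openin_quotient_topology
    by (rule conjunct1)
  have "{x \<in> topspace X. f x \<in> f ` topspace X} = topspace X" by blast
  then have "openin (quotient_topology X f) (f ` topspace X)"
    unfolding openin_quotient_topology by auto
  then show "f ` topspace X \<subseteq> topspace (quotient_topology X f)"
    by (rule openin_subset)
qed

lemma quotient_map_quotient_topology: "quotient_map X (quotient_topology X f) f"
  unfolding quotient_map_def by (auto simp: openin_quotient_topology)

section \<open>Configuration spaces and partitions of multivalued maps\<close>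

definition ordered_conf :: "nat \<Rightarrow> 'a topology \<Rightarrow> (nat \<Rightarrow> 'a) topology" where
  "ordered_conf n Y =
     subtopology (product_topology (\<lambda>_. Y) {..<n}) {y. inj_on y {..<n}}"

text \<open>Two injective tuples have the same set of entries exactly when they differ by a
  permutation, so the quotient by the symmetric group is the quotient along the map sending
  a tuple to its set of entries.\<close>

definition unordered_conf :: "nat \<Rightarrow> 'a topology \<Rightarrow> 'a set topology" where
  "unordered_conf n Y = quotient_topology (ordered_conf n Y) (\<lambda>y. y ` {..<n})"

lemma topspace_unordered_conf:
  "topspace (unordered_conf n Y) = {S. S \<subseteq> topspace Y \<and> finite S \<and> card S = n}"
proof (intro set_eqI iffI)
  fix S assume "S \<in> topspace (unordered_conf n Y)"
  then obtain y where "S = y ` {..<n}" "y \<in> (\<Pi>\<^sub>E i\<in>{..<n}. topspace Y)" "inj_on y {..<n}"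
    unfolding unordered_conf_def topspace_quotient_topology ordered_conf_def by auto
  then show "S \<in> {S. S \<subseteq> topspace Y \<and> finite S \<and> card S = n}"
    using card_image[of y "{..<n}"] by (simp add: image_subset_iff PiE_iff)
next
  fix S assume "S \<in> {S. S \<subseteq> topspace Y \<and> finite S \<and> card S = n}"
  then have S: "S \<subseteq> topspace Y" "finite S" "card S = n" by auto
  obtain h where h: "bij_betw h {0..<card S} S"
    using ex_bij_betw_nat_finite[OF S(2)] by blast
  define y where "y = restrict h {..<n}"
  have h': "h ` {..<n} = S" "inj_on h {..<n}"
    using h S(3) by (simp_all add: bij_betw_def atLeast0LessThan)
  have 1: "y ` {..<n} = S"
    using h'(1) by (simp add: y_def)
  have 2: "inj_on y {..<n}"
    using h'(2) by (simp add: y_def inj_on_def)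
  have "y \<in> (\<Pi>\<^sub>E i\<in>{..<n}. topspace Y)"
    using 1 S(1) unfolding y_def by (intro restrict_PiE_iff[THEN iffD2]) auto
  with 2 have "y \<in> topspace (ordered_conf n Y)"
    by (simp add: ordered_conf_def)
  then show "S \<in> topspace (unordered_conf n Y)"
    unfolding unordered_conf_def topspace_quotient_topology 1[symmetric] by (rule imageI)
qed

definition multivalued_map :: "nat \<Rightarrow> 'a topology \<Rightarrow> 'b topology \<Rightarrow> ('a \<Rightarrow> 'b set) \<Rightarrow> bool" where
  "multivalued_map n X Y f \<longleftrightarrow> continuous_map X (unordered_conf n Y) f"

definition multivalued_homotopic ::
    "nat \<Rightarrow> 'a topology \<Rightarrow> 'b topology \<Rightarrow> ('a \<Rightarrow> 'b set) \<Rightarrow> ('a \<Rightarrow> 'b set) \<Rightarrow> bool" where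
  "multivalued_homotopic n X Y f g \<longleftrightarrow> homotopic_with (\<lambda>_. True) X (unordered_conf n Y) f g"

text \<open>The partition \<open>{g 0, \<dots>, g (s - 1)}\<close>, with \<open>g i\<close> a \<open>k i\<close>-valued map. If \<open>X\<close> is nonempty, the maps are
  automatically distinct: the \<open>k i\<close> are positive and add up to \<open>n\<close>, so the values
  \<open>g i x\<close> are nonempty and pairwise disjoint.\<close>

definition partition_into ::
    "nat \<Rightarrow> 'a topology \<Rightarrow> 'b topology \<Rightarrow> ('a \<Rightarrow> 'b set) \<Rightarrow>
     nat \<Rightarrow> (nat \<Rightarrow> nat) \<Rightarrow> (nat \<Rightarrow> 'a \<Rightarrow> 'b set) \<Rightarrow> bool" where
  "partition_into n X Y f s k g \<longleftrightarrow>
     multivalued_map n X Y f \<and>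
     (\<forall>i<s. 0 < k i \<and> multivalued_map (k i) X Y (g i)) \<and>
     (\<Sum>i<s. k i) = n \<and>
     (\<forall>x\<in>topspace X. f x = (\<Union>i<s. g i x))"

definition has_nontrivial_partition ::
    "nat \<Rightarrow> 'a topology \<Rightarrow> 'b topology \<Rightarrow> ('a \<Rightarrow> 'b set) \<Rightarrow> bool" where
  "has_nontrivial_partition n X Y f \<longleftrightarrow> (\<exists>s\<ge>2. \<exists>k g. partition_into n X Y f s k g)"

section \<open>Tori and linear multivalued maps\<close>

text \<open>Points of the torus are cosets of the integer lattice.\<close>

definition torus_proj :: "real^'q \<Rightarrow> (real^'q) set" where
  "torus_proj t = {s. \<forall>i. s $ i - t $ i \<in> \<int>}"

definition torus :: "(real^'q) set topology" where
  "torus = quotient_topology euclidean torus_proj"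

definition linear_lift :: "nat \<Rightarrow> int^'q^'q \<Rightarrow> int \<Rightarrow> real^'q \<Rightarrow> real^'q" where
  "linear_lift n A k t =
     (1 / real n) *\<^sub>R (map_matrix real_of_int A *v t + real_of_int k *\<^sub>R (\<chi> i. 1))"

text \<open>Independence of the chosen lift \<open>t\<close> requires the rows of \<open>A\<close> to be congruent to one
  another modulo \<open>n\<close>; see \<open>linear_multimap_proj\<close>.\<close>

definition linear_multimap :: "nat \<Rightarrow> int^'q^'q \<Rightarrow> (real^'q) set \<Rightarrow> (real^'q) set set" where
  "linear_multimap n A x =
     (let t = (SOME t. torus_proj t = x)
      in torus_proj ` (\<lambda>k. linear_lift n A k t) ` {1..int n})"

lemma torus_proj_eq_iff: "torus_proj s = torus_proj t \<longleftrightarrow> (\<forall>i. s $ i - t $ i \<in> \<int>)"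
proof
  assume "torus_proj s = torus_proj t"
  moreover have "s \<in> torus_proj s" by (simp add: torus_proj_def)
  ultimately show "\<forall>i. s $ i - t $ i \<in> \<int>" by (auto simp: torus_proj_def)
next
  assume st: "\<forall>i. s $ i - t $ i \<in> \<int>"
  have "u $ i - s $ i \<in> \<int> \<longleftrightarrow> u $ i - t $ i \<in> \<int>" for u i
  proof
    assume "u $ i - s $ i \<in> \<int>"
    then have "(u $ i - s $ i) + (s $ i - t $ i) \<in> \<int>" using st by (blast intro: Ints_add)
    then show "u $ i - t $ i \<in> \<int>" by simp
  next
    assume "u $ i - t $ i \<in> \<int>"
    then have "(u $ i - t $ i) - (s $ i - t $ i) \<in> \<int>" using st by (blast intro: Ints_diff)
    then show "u $ i - s $ i \<in> \<int>" by simp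
  qed
  then show "torus_proj s = torus_proj t" by (simp add: torus_proj_def)
qed

lemma linear_lift_nth:
  "linear_lift n A k t $ i = ((\<Sum>j\<in>UNIV. real_of_int (A $ i $ j) * t $ j) + real_of_int k) / real n"
  by (simp add: linear_lift_def matrix_vector_mult_def)

lemma linear_lift_proj_mod:
  assumes "0 < n" "k mod int n = k' mod int n"
  shows "torus_proj (linear_lift n A k t) = torus_proj (linear_lift n A k' t)"
proof -
  obtain z where "k - k' = int n * z" using assms(2) unfolding mod_eq_dvd_iff dvd_def by blast
  then have z: "k = k' + int n * z" by simp
  show ?thesis unfolding torus_proj_eq_iff linear_lift_nth
  proof
    fix i
    have "((\<Sum>j\<in>UNIV. real_of_int (A $ i $ j) * t $ j) + real_of_int k) / real n -
      ((\<Sum>j\<in>UNIV. real_of_int (A $ i $ j) * t $ j) + real_of_int k') / real n = of_int z"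
      using assms(1) by (simp add: z field_simps)
    then show "((\<Sum>j\<in>UNIV. real_of_int (A $ i $ j) * t $ j) + real_of_int k) / real n -
      ((\<Sum>j\<in>UNIV. real_of_int (A $ i $ j) * t $ j) + real_of_int k') / real n \<in> \<int>" by simp
  qed
qed

lemma linear_lift_proj_image_subset:
  fixes A :: "int^'q^'q"
  assumes n: "0 < n" and A: "\<And>i i' j. A $ i $ j mod int n = A $ i' $ j mod int n"
    and st: "torus_proj s = torus_proj t"
  shows "torus_proj ` (\<lambda>k. linear_lift n A k s) ` {1..int n}
       \<subseteq> torus_proj ` (\<lambda>k. linear_lift n A k t) ` {1..int n}"
proof clarify
  fix k assume k: "k \<in> {1..int n}"
  have "\<forall>j. \<exists>w. s $ j - t $ j = real_of_int w"
    using st unfolding torus_proj_eq_iff Ints_def by blast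
  then obtain z where z: "\<And>j. s $ j - t $ j = real_of_int (z j)" by metis
  define d where "d i = (\<Sum>j\<in>UNIV. A $ i $ j * z j)" for i
  have dmod: "d i mod int n = d i' mod int n" for i i'
  proof -
    have "[A $ i $ j * z j = A $ i' $ j * z j] (mod int n)" for j
      by (rule cong_mult[OF _ cong_refl]) (simp add: cong_def A[of i j i'])
    then have "[d i = d i'] (mod int n)" unfolding d_def by (rule cong_sum)
    then show ?thesis by (simp add: cong_def)
  qed
  define i0 :: 'q where "i0 = undefined"
  define k' where "k' = (k + d i0 - 1) mod int n + 1"
  have k': "k' \<in> {1..int n}" using n unfolding k'_def atLeastAtMost_iff
    using pos_mod_bound[of "int n" "k + d i0 - 1"] pos_mod_sign[of "int n" "k + d i0 - 1"]
    by linarith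
  have "torus_proj (linear_lift n A k s) = torus_proj (linear_lift n A (k + d i0) t)"
    unfolding torus_proj_eq_iff
  proof
    fix i
    obtain w where "d i - d i0 = int n * w"
      using dmod[of i i0] unfolding mod_eq_dvd_iff dvd_def by blast
    then have w: "d i = d i0 + int n * w" by simp
    have "(\<Sum>j\<in>UNIV. real_of_int (A $ i $ j) * s $ j) =
          (\<Sum>j\<in>UNIV. real_of_int (A $ i $ j) * t $ j) + real_of_int (d i)"
      unfolding d_def of_int_sum of_int_mult z[symmetric] sum.distrib[symmetric]
      by (rule sum.cong) (auto simp: algebra_simps)
    then have "linear_lift n A k s $ i - linear_lift n A (k + d i0) t $ i = of_int w"
      using n unfolding linear_lift_nth by (simp add: w field_simps)
    then show "linear_lift n A k s $ i - linear_lift n A (k + d i0) t $ i \<in> \<int>" by simp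
  qed
  also have "\<dots> = torus_proj (linear_lift n A k' t)"
    by (rule linear_lift_proj_mod[OF n]) (simp add: k'_def mod_simps)
  finally show "torus_proj (linear_lift n A k s) \<in>
      torus_proj ` (\<lambda>k. linear_lift n A k t) ` {1..int n}" using k' by blast
qed

lemma linear_multimap_proj:
  fixes A :: "int^'q^'q"
  assumes "0 < n" "\<And>i i' j. [A $ i $ j = A $ i' $ j] (mod int n)"
  shows "linear_multimap n A (torus_proj t) =
           torus_proj ` (\<lambda>k. linear_lift n A k t) ` {1..int n}"
proof -
  define s where "s = (SOME s. torus_proj s = torus_proj t)"
  have s: "torus_proj s = torus_proj t" unfolding s_def by (rule someI[of _ t]) simp
  show ?thesis
    unfolding linear_multimap_def Let_def s_def[symmetric]
    by (intro equalityI linear_lift_proj_image_subset assms(1) s s[symmetric]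
          assms(2)[unfolded cong_def])
qed

lemma linear_lift_proj_inj:
  "inj_on (\<lambda>k. torus_proj (linear_lift n A k t)) {1..int n}"
proof
  fix k k' assume k: "k \<in> {1..int n}" "k' \<in> {1..int n}"
    and eq: "torus_proj (linear_lift n A k t) = torus_proj (linear_lift n A k' t)"
  then have "linear_lift n A k t $ undefined - linear_lift n A k' t $ undefined \<in> \<int>"
    unfolding torus_proj_eq_iff by blast
  then obtain w where w: "real_of_int (k - k') / real n = of_int w"
    unfolding linear_lift_nth Ints_def by (auto simp: diff_divide_distrib add_divide_distrib)
  have "0 < n" using k by auto
  with w have "real_of_int (k - k') = real_of_int (w * int n)" by (simp add: field_simps)
  then have "k - k' = w * int n" by (simp only: of_int_eq_iff)
  moreover have "\<bar>k - k'\<bar> < int n" using k by auto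
  ultimately have "\<bar>w\<bar> * int n < int n" by (simp add: abs_mult)
  then have "w = 0" using \<open>0 < n\<close> by (simp add: mult_less_cancel_right1)
  then show "k = k'" using \<open>k - k' = w * int n\<close> by simp
qed

lemma multivalued_map_linear_multimap:
  fixes A :: "int^'q^'q"
  assumes n: "0 < n" and A: "\<And>i i' j. [A $ i $ j = A $ i' $ j] (mod int n)"
  shows "multivalued_map n torus torus (linear_multimap n A)"
proof -
  let ?y = "\<lambda>t. \<lambda>i\<in>{..<n}. torus_proj (linear_lift n A (int i + 1) t)"
  have qp: "quotient_map euclidean torus (torus_proj :: real^'q \<Rightarrow> _)"
    unfolding torus_def by (rule quotient_map_quotient_topology)
  have comp: "continuous_map euclidean torus (\<lambda>t. torus_proj (linear_lift n A k t))" for k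
  proof -
    have "continuous_map euclidean euclidean (linear_lift n A k)"
      unfolding linear_lift_def by (auto intro!: continuous_intros matrix_vector_mult_linear_continuous_on)
    from continuous_map_compose[OF this quotient_imp_continuous_map[OF qp]]
    show ?thesis by (simp add: o_def)
  qed
  have inj: "inj_on (?y t) {..<n}" for t
  proof (rule inj_onI)
    fix i j assume ij: "i \<in> {..<n}" "j \<in> {..<n}" and "?y t i = ?y t j"
    then have "torus_proj (linear_lift n A (int i + 1) t) =
               torus_proj (linear_lift n A (int j + 1) t)" by simp
    then have "int i + 1 = int j + 1"
      by (rule inj_onD[OF linear_lift_proj_inj]) (use ij in auto)
    then show "i = j" by simp
  qed
  have img: "?y t ` {..<n} = linear_multimap n A (torus_proj t)" for t
  proof -
    have eq: "(\<lambda>i. int i + 1) ` {..<n} = {1..int n}"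
    proof (intro equalityI subsetI)
      fix k assume "k \<in> {1..int n}"
      then show "k \<in> (\<lambda>i. int i + 1) ` {..<n}" by (intro image_eqI[where x = "nat (k - 1)"]) auto
    qed auto
    then show ?thesis
      unfolding linear_multimap_proj[OF n A] eq[symmetric] image_image by simp
  qed
  have "continuous_map euclidean (ordered_conf n torus) ?y"
    unfolding ordered_conf_def continuous_map_in_subtopology continuous_map_componentwise
    using comp inj by auto
  then have "continuous_map euclidean (unordered_conf n torus) ((\<lambda>y. y ` {..<n}) \<circ> ?y)"
    unfolding unordered_conf_def
    by (rule continuous_map_compose)
      (rule quotient_imp_continuous_map[OF quotient_map_quotient_topology])
  then have "continuous_map euclidean (unordered_conf n torus) (linear_multimap n A \<circ> torus_proj)"
    unfolding o_def img .
  then show ?thesis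
    unfolding multivalued_map_def by (rule continuous_compose_quotient_map[OF qp])
qed

end

theory Submission
  imports Defs
begin

text \<open>Along the covering map the branches of \<open>f\<close> are labelled by the residues \<open>r\<close> modulo \<open>n\<close>. For a
  member \<open>g\<close> of a partition, the set of \<open>t\<close> at which branch \<open>r\<close> lies in \<open>g\<close> is clopen, so \<open>g\<close> selects a
  set of residues not depending on \<open>t\<close>. Going around the \<open>j\<close>-th coordinate circle turns branch \<open>r\<close>
  into branch \<open>r + l j\<close>, so this set has all \<open>l j\<close> and \<open>n\<close> as periods; if it is neither empty
  nor everything, its least period is a common factor larger than 1. Conversely, each residue
  class modulo a common factor \<open>m\<close> selects a translate of the linear map induced by \<open>A / m\<close>, and
  scaling the translation vector to 0 is a homotopy.\<close>

section \<open>Periods of a predicate on the integers\<close>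

lemma common_period_divisor:
  fixes Q :: "int \<Rightarrow> bool"
  assumes "0 < n" "\<And>r. Q (r + n) \<longleftrightarrow> Q r" "Q a" "\<not> Q b"
  obtains m where "1 < m" "\<And>d. (\<And>r. Q (r + d) \<longleftrightarrow> Q r) \<Longrightarrow> m dvd d"
proof -
  \<comment> \<open>The periods form a subgroup of the integers containing \<open>n\<close>, hence
    consist of the multiples of their least positive element \<open>m\<close>.\<close>
  define D where "D = {d. \<forall>r. Q (r + d) \<longleftrightarrow> Q r}"
  define m where "m = int (LEAST k. 0 < k \<and> int k \<in> D)"
  have "0 < nat n \<and> int (nat n) \<in> D"
    using assms(1,2) by (simp add: D_def)
  then have "0 < (LEAST k. 0 < k \<and> int k \<in> D) \<and> m \<in> D"
    unfolding m_def by (rule LeastI)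
  then have m: "0 < m" "m \<in> D"
    by (simp_all add: m_def)
  have least: "m \<le> d" if "0 < d" "d \<in> D" for d
    using Least_le[of "\<lambda>k. 0 < k \<and> int k \<in> D" "nat d"] that by (simp add: m_def)
  have diff: "d - e \<in> D" if "d \<in> D" "e \<in> D" for d e
  proof -
    have "Q (r + (d - e)) \<longleftrightarrow> Q r" for r
      using that[unfolded D_def mem_Collect_eq, THEN spec, of "r - e"]
      by (simp add: algebra_simps)
    then show ?thesis by (simp add: D_def)
  qed
  have mult: "int k * m \<in> D" for k
  proof (induction k)
    case 0
    then show ?case by (simp add: D_def)
  next
    case (Suc k)
    have "0 - m \<in> D" using m(2) diff[of m m] diff[of 0 m] by simp
    from diff[OF Suc this] show ?case by (simp add: algebra_simps)
  qed
  have mult': "z * m \<in> D" for z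
  proof (cases "0 \<le> z")
    case True
    then show ?thesis using mult[of "nat z"] by simp
  next
    case False
    then show ?thesis using diff[OF mult[of 0] mult[of "nat (- z)"]] by simp
  qed
  have dvd: "m dvd d" if "d \<in> D" for d
  proof -
    have "d mod m \<in> D"
      using diff[OF that mult'[of "d div m"]] by (simp add: minus_div_mult_eq_mod)
    with least[of "d mod m"] m(1) have "d mod m = 0"
      using pos_mod_bound[of m d] pos_mod_sign[of m d] by linarith
    then show ?thesis by blast
  qed
  \<comment> \<open>Period 1 would make \<open>Q\<close> constant, contradicting \<open>a\<close>
    and \<open>b\<close>.\<close>
  have "m \<noteq> 1"
  proof
    assume "m = 1"
    then have "Q (b + (a - b)) \<longleftrightarrow> Q b"
      using mult'[of "a - b"] by (simp only: D_def mem_Collect_eq mult_1_right)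
    with assms(3,4) show False by simp
  qed
  with m(1) dvd show thesis by (intro that[of m]) (auto simp: D_def)
qed

section \<open>Maps into configuration spaces\<close>

text \<open>Pulled back to ordered configurations, the condition cuts out the open box with all
  sides \<open>U\<close>. It supplies neighbourhoods of a value of a multivalued map.\<close>

lemma openin_unordered_conf_subset:
  assumes "openin Y U"
  shows "openin (unordered_conf n Y) {S \<in> topspace (unordered_conf n Y). S \<subseteq> U}"
proof -
  have "openin (product_topology (\<lambda>_. Y) {..<n}) (\<Pi>\<^sub>E i\<in>{..<n}. U)"
    using assms by (simp add: openin_PiE_gen)
  then have "openin (ordered_conf n Y) ((\<Pi>\<^sub>E i\<in>{..<n}. U) \<inter> {y. inj_on y {..<n}})"
    unfolding ordered_conf_def by (rule openin_subtopology_Int)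
  moreover have "(\<Pi>\<^sub>E i\<in>{..<n}. U) \<inter> {y. inj_on y {..<n}} =
      {y \<in> topspace (ordered_conf n Y). y ` {..<n} \<subseteq> U}"
    using openin_subset[OF assms] by (auto simp: ordered_conf_def PiE_iff extensional_def)
  moreover have "\<dots> = {y \<in> topspace (ordered_conf n Y).
        y ` {..<n} \<in> {S \<in> topspace (unordered_conf n Y). S \<subseteq> U}}"
    unfolding unordered_conf_def topspace_quotient_topology by blast
  ultimately have "openin (ordered_conf n Y) {y \<in> topspace (ordered_conf n Y).
        y ` {..<n} \<in> {S \<in> topspace (unordered_conf n Y). S \<subseteq> U}}"
    by (simp only:)
  moreover have "{S \<in> topspace (unordered_conf n Y). S \<subseteq> U} \<subseteq>
      (\<lambda>y. y ` {..<n}) ` topspace (ordered_conf n Y)"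
    unfolding unordered_conf_def topspace_quotient_topology by blast
  ultimately show ?thesis
    by (simp only: unordered_conf_def openin_quotient_topology simp_thms)
qed

text \<open>If \<open>h x\<close> lies outside the finite, hence compact, set \<open>g x\<close>,
  disjoint open sets separate the two. By continuity they still do so at nearby points, so
  non-membership is an open condition.\<close>

lemma closedin_mem_multivalued_map:
  assumes Y: "Hausdorff_space Y" and h: "continuous_map X Y h"
    and g: "multivalued_map n X Y g"
  shows "closedin X {x \<in> topspace X. h x \<in> g x}"
proof -
  have g': "continuous_map X (unordered_conf n Y) g"
    using g by (simp add: multivalued_map_def)
  have "openin X {x \<in> topspace X. h x \<notin> g x}"
  proof (subst openin_subopen, clarify)
    fix x assume x: "x \<in> topspace X" "h x \<notin> g x"
    have "g x \<in> topspace (unordered_conf n Y)" "h x \<in> topspace Y"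
      using x g' h by (auto simp: continuous_map_def Pi_iff)
    then have "compactin Y (g x)" "compactin Y {h x}"
      by (auto simp: topspace_unordered_conf intro: finite_imp_compactin)
    then obtain U V where UV: "openin Y U" "openin Y V" "g x \<subseteq> U" "{h x} \<subseteq> V" "disjnt U V"
      using Hausdorff_space_compact_separation[OF Y, of "g x" "{h x}"] x by auto
    let ?N = "{z \<in> topspace X. g z \<in> {S \<in> topspace (unordered_conf n Y). S \<subseteq> U}} \<inter>
      {z \<in> topspace X. h z \<in> V}"
    have "openin X ?N"
      by (intro openin_Int openin_continuous_map_preimage[OF g'] openin_continuous_map_preimage[OF h]
          openin_unordered_conf_subset UV)
    moreover have "x \<in> ?N"
      using x UV \<open>g x \<in> _\<close> by auto
    moreover have "?N \<subseteq> {x \<in> topspace X. h x \<notin> g x}"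
      using UV(5) by (auto simp: disjnt_def)
    ultimately show "\<exists>T. openin X T \<and> x \<in> T \<and> T \<subseteq> {x \<in> topspace X. h x \<notin> g x}"
      by blast
  qed
  moreover have "topspace X - {x \<in> topspace X. h x \<in> g x} = {x \<in> topspace X. h x \<notin> g x}"
    by blast
  ultimately show ?thesis
    by (simp add: closedin_def)
qed

text \<open>Enumerating \<open>I\<close> lifts the map to ordered configurations, where continuity
  is componentwise.\<close>

lemma continuous_map_unordered_conf:
  assumes "\<And>i. i \<in> I \<Longrightarrow> continuous_map X Y (h i)" and I: "finite I" "card I = n"
    and inj: "\<And>x. x \<in> topspace X \<Longrightarrow> inj_on (\<lambda>i. h i x) I"
  shows "continuous_map X (unordered_conf n Y) (\<lambda>x. (\<lambda>i. h i x) ` I)"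
proof -
  obtain e where e: "bij_betw e {..<n} I"
    using ex_bij_betw_nat_finite[OF I(1)] I(2) by (auto simp: atLeast0LessThan)
  let ?y = "\<lambda>x. \<lambda>i\<in>{..<n}. h (e i) x"
  have "inj_on (?y x) {..<n}" if "x \<in> topspace X" for x
    using comp_inj_on[of e "{..<n}" "\<lambda>i. h i x"] e inj[OF that]
    by (auto simp: bij_betw_def inj_on_def)
  moreover have "continuous_map X Y (h (e i))" if "i < n" for i
    using that e assms(1) by (auto simp: bij_betw_def)
  ultimately have "continuous_map X (ordered_conf n Y) ?y"
    unfolding ordered_conf_def continuous_map_in_subtopology continuous_map_componentwise
    by auto
  then have "continuous_map X (unordered_conf n Y) ((\<lambda>y. y ` {..<n}) \<circ> ?y)"
    unfolding unordered_conf_def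
    by (rule continuous_map_compose)
      (rule quotient_imp_continuous_map[OF quotient_map_quotient_topology])
  moreover have "(\<lambda>y. y ` {..<n}) \<circ> ?y = (\<lambda>x. (\<lambda>i. h i x) ` e ` {..<n})"
    by (auto simp: fun_eq_iff image_image)
  ultimately show ?thesis using e by (simp add: bij_betw_def)
qed

section \<open>The torus\<close>

lemma quotient_map_torus_proj: "quotient_map euclidean torus torus_proj"
  unfolding torus_def by (rule quotient_map_quotient_topology)

lemma topspace_torus [simp]: "topspace torus = range torus_proj"
  by (simp add: torus_def)

text \<open>A continuous real function separates any two distinct points; preimages of disjoint open
  sets of reals do the rest.\<close>

lemma Hausdorff_space_torus: "Hausdorff_space (torus :: (real^'q) set topology)"
  unfolding Hausdorff_space_def
proof clarify
  fix x y :: "(real^'q) set"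
  assume "x \<in> topspace torus" "y \<in> topspace torus" and ne: "x \<noteq> y"
  then obtain a b where ab: "x = torus_proj a" "y = torus_proj b" by auto
  with ne obtain i where i: "a $ i - b $ i \<notin> \<int>"
    by (auto simp: torus_proj_eq_iff)
  \<comment> \<open>Well defined on cosets, and equal to 1 at \<open>y\<close> but not at \<open>x\<close>.\<close>
  define \<phi> where "\<phi> z = cos (2 * pi * ((SOME t. torus_proj t = z) $ i - b $ i))" for z
  have \<phi>: "\<phi> (torus_proj t) = cos (2 * pi * (t $ i - b $ i))" for t
  proof -
    define s where "s = (SOME s. torus_proj s = torus_proj t)"
    have "torus_proj s = torus_proj t" unfolding s_def by (rule someI[of _ t]) simp
    then obtain w where "s $ i - t $ i = of_int w"
      unfolding torus_proj_eq_iff Ints_def by blast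
    then have "2 * pi * (s $ i - b $ i) = 2 * pi * (t $ i - b $ i) + of_int w * (2 * pi)"
      by (simp add: algebra_simps)
    then have "cos (2 * pi * (s $ i - b $ i)) = cos (2 * pi * (t $ i - b $ i))"
      by (simp add: cos_add cos_int_2pin sin_int_2pin mult.commute[of "of_int w"])
    then show ?thesis by (simp add: \<phi>_def s_def)
  qed
  have "continuous_map euclidean euclidean (\<phi> \<circ> torus_proj)"
    unfolding o_def \<phi> by (auto intro!: continuous_intros)
  then have cont: "continuous_map torus euclidean \<phi>"
    by (rule continuous_compose_quotient_map[OF quotient_map_torus_proj])
  have "\<phi> x \<noteq> \<phi> y"
  proof
    assume "\<phi> x = \<phi> y"
    then obtain k :: int where "2 * pi * (a $ i - b $ i) = of_int k * 2 * pi"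
      by (auto simp: ab \<phi> cos_one_2pi_int)
    then have "a $ i - b $ i = of_int k" by simp
    with i show False by simp
  qed
  then obtain U V where UV: "open U" "open V" "\<phi> x \<in> U" "\<phi> y \<in> V" "U \<inter> V = {}"
    using hausdorff[OF \<open>\<phi> x \<noteq> \<phi> y\<close>] by auto
  then show "\<exists>U V. openin torus U \<and> openin torus V \<and> x \<in> U \<and> y \<in> V \<and> disjnt U V"
    using openin_continuous_map_preimage[OF cont, of U]
      openin_continuous_map_preimage[OF cont, of V] ab
    by (intro exI[of _ "{z \<in> topspace torus. \<phi> z \<in> U}"] exI[of _ "{z \<in> topspace torus. \<phi> z \<in> V}"])
      (auto simp: disjnt_def)
qed

lemma continuous_map_torus_proj_lift:
  "continuous_map euclidean torus (\<lambda>t. torus_proj (linear_lift n A k t))"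
proof -
  have "continuous_map euclidean euclidean (linear_lift n A k)"
    unfolding linear_lift_def
    by (auto intro!: continuous_intros matrix_vector_mult_linear_continuous_on)
  from continuous_map_compose[OF this quotient_imp_continuous_map[OF quotient_map_torus_proj]]
  show ?thesis by (simp add: o_def)
qed

text \<open>Torus points are cosets, so taking images under \<open>\<lambda>s. s + v\<close>
  translates them without a choice of representative.\<close>

lemma image_add_torus_proj: "(\<lambda>s. s + v) ` torus_proj t = torus_proj (t + v)"
proof (intro equalityI subsetI)
  fix u assume "u \<in> torus_proj (t + v)"
  then show "u \<in> (\<lambda>s. s + v) ` torus_proj t"
    by (intro image_eqI[of _ _ "u - v"]) (auto simp: torus_proj_def algebra_simps)
qed (auto simp: torus_proj_def)

lemma torus_proj_add_cancel:
  "torus_proj (s + v) = torus_proj (t + v) \<longleftrightarrow> torus_proj s = torus_proj t"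
  by (simp add: torus_proj_eq_iff)

text \<open>The homotopy translates all values by \<open>a *\<^sub>R v\<close> at time
  \<open>a\<close>. A common translation keeps them distinct, so every stage is
  \<open>n\<close>-valued.\<close>

lemma multivalued_homotopic_translation:
  fixes A :: "int^'q^'q"
  assumes n: "0 < n" and A: "\<And>i i' j. [A $ i $ j = A $ i' $ j] (mod int n)"
  shows "multivalued_homotopic n torus torus (linear_multimap n A)
           (\<lambda>x. (`) (\<lambda>s. s + v) ` linear_multimap n A x)"
proof -
  let ?I = "top_of_set {0..1::real}"
  let ?H = "\<lambda>(a, x). (`) (\<lambda>s. s + a *\<^sub>R v) ` linear_multimap n A x"
  let ?h = "\<lambda>k (a, t). torus_proj (linear_lift n A k t + a *\<^sub>R v)"
  \<comment> \<open>The interval is locally compact Hausdorff, so its product with the covering map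
    is still a quotient map, and continuity of \<open>?H\<close> can be checked upstairs, where the
    branches are separate maps.\<close>
  have q: "quotient_map (prod_topology ?I euclidean) (prod_topology ?I torus)
      (\<lambda>(a, t). (a, torus_proj t))"
    by (intro quotient_map_prod_right quotient_map_torus_proj disjI1 Hausdorff_space_subtopology
        compact_imp_locally_compact_space compact_space_subtopology) auto
  have "continuous_map (prod_topology ?I euclidean) torus (?h k)" for k
  proof -
    have "continuous_map (prod_topology euclidean euclidean) euclidean
        (\<lambda>(a, t). linear_lift n A k t + a *\<^sub>R v)"
      unfolding linear_lift_def split_def euclidean_product_topology
      by (auto intro!: continuous_intros continuous_on_compose2[OF
            matrix_vector_mult_linear_continuous_on, of UNIV])
    then have "continuous_map (prod_topology ?I euclidean) euclidean
        (\<lambda>(a, t). linear_lift n A k t + a *\<^sub>R v)"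
      by (metis continuous_map_from_subtopology prod_topology_subtopology(1))
    from continuous_map_compose[OF this quotient_imp_continuous_map[OF quotient_map_torus_proj]]
    show ?thesis by (simp add: o_def split_def)
  qed
  moreover have "inj_on (\<lambda>k. ?h k z) {1..int n}" for z
    using linear_lift_proj_inj[of n A "snd z"]
    by (simp add: inj_on_def split_def torus_proj_add_cancel)
  ultimately have "continuous_map (prod_topology ?I euclidean) (unordered_conf n torus)
      (\<lambda>z. (\<lambda>k. ?h k z) ` {1..int n})"
    by (intro continuous_map_unordered_conf) auto
  also have "(\<lambda>z. (\<lambda>k. ?h k z) ` {1..int n}) = ?H \<circ> (\<lambda>(a, t). (a, torus_proj t))"
    by (auto simp: linear_multimap_proj[OF n A] image_image image_add_torus_proj fun_eq_iff)
  finally have "continuous_map (prod_topology ?I torus) (unordered_conf n torus) ?H"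
    by (rule continuous_compose_quotient_map[OF q])
  then show ?thesis
    unfolding multivalued_homotopic_def homotopic_with_def by (intro exI[of _ ?H]) simp
qed

section \<open>Partitions of linear maps\<close>

text \<open>Adding the \<open>j\<close>-th unit vector adds column \<open>j\<close> of
  \<open>A\<close> before division by \<open>n\<close>. Its entries are \<open>l $ j\<close> plus
  multiples of \<open>n\<close>: the first part shifts the branch index, the second contributes
  integers.\<close>

lemma linear_lift_proj_add_axis:
  fixes A :: "int^'q^'q"
  assumes n: "0 < n" and A: "\<And>i j. [A $ i $ j = l $ j] (mod int n)"
  shows "torus_proj (linear_lift n A r (t + axis j 1)) = torus_proj (linear_lift n A (r + l $ j) t)"
  unfolding torus_proj_eq_iff
proof
  fix i
  obtain w where "A $ i $ j - l $ j = int n * w"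
    using A[of i j] unfolding cong_iff_dvd_diff dvd_def by blast
  then have w: "A $ i $ j = l $ j + int n * w" by simp
  have "(\<Sum>j'\<in>UNIV. real_of_int (A $ i $ j') * (t + axis j 1) $ j') =
      (\<Sum>j'\<in>UNIV. real_of_int (A $ i $ j') * t $ j' + (if j' = j then real_of_int (A $ i $ j') else 0))"
    by (rule sum.cong) (auto simp: axis_def algebra_simps)
  also have "\<dots> = (\<Sum>j'\<in>UNIV. real_of_int (A $ i $ j') * t $ j') + real_of_int (A $ i $ j)"
    by (simp add: sum.distrib)
  finally have "linear_lift n A r (t + axis j 1) $ i - linear_lift n A (r + l $ j) t $ i = of_int w"
    using n unfolding linear_lift_nth by (simp add: w field_simps)
  then show "linear_lift n A r (t + axis j 1) $ i - linear_lift n A (r + l $ j) t $ i \<in> \<int>"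
    by simp
qed

text \<open>The sizes \<open>k j\<close> add up to \<open>n\<close>, the cardinality of the union,
  which leaves no room for overlap.\<close>

lemma partition_into_disjoint:
  assumes "partition_into n X Y f s k g" "x \<in> topspace X" "i < s"
  shows "g i x \<inter> (\<Union>j\<in>{..<s} - {i}. g j x) = {}"
proof -
  let ?R = "\<Union>j\<in>{..<s} - {i}. g j x"
  have g: "finite (g j x) \<and> card (g j x) = k j" if "j < s" for j
  proof -
    have "continuous_map X (unordered_conf (k j) Y) (g j)"
      using assms(1) that by (simp add: partition_into_def multivalued_map_def)
    then have "g j x \<in> topspace (unordered_conf (k j) Y)"
      using assms(2) by (auto simp: continuous_map_def)
    then show ?thesis by (simp add: topspace_unordered_conf)
  qed
  have "f x \<in> topspace (unordered_conf n Y)"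
    using assms(1,2) unfolding partition_into_def multivalued_map_def continuous_map_def by blast
  then have "n = card (f x)" by (simp add: topspace_unordered_conf)
  also have "f x = g i x \<union> ?R"
    using assms by (auto simp: partition_into_def)
  finally have n: "n = card (g i x \<union> ?R)" .
  have "card ?R \<le> (\<Sum>j\<in>{..<s} - {i}. card (g j x))"
    by (rule card_UN_le) simp
  also have "\<dots> = (\<Sum>j\<in>{..<s} - {i}. k j)"
    using g by (intro sum.cong) auto
  finally have "card (g i x) + card ?R \<le> k i + (\<Sum>j\<in>{..<s} - {i}. k j)"
    using g[OF assms(3)] by simp
  also have "\<dots> = (\<Sum>j<s. k j)"
    using assms(3) by (simp add: sum.remove)
  also have "\<dots> = n"
    using assms(1) by (simp add: partition_into_def)
  finally have "card (g i x) + card ?R \<le> n" .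
  moreover have fin: "finite (g i x)" "finite ?R"
    using g assms(3) by auto
  ultimately have "card (g i x \<inter> ?R) = 0"
    using card_Un_Int[OF fin] n by linarith
  then show ?thesis using fin by simp
qed

text \<open>The points \<open>t\<close> at which the \<open>r\<close>-th branch lies in \<open>g i\<close> form a clopen subset of the
  connected covering space.\<close>

lemma partition_branch_constant:
  fixes A :: "int^'q^'q"
  assumes n: "0 < n" and A: "\<And>i i' j. [A $ i $ j = A $ i' $ j] (mod int n)"
    and part: "partition_into n torus torus (linear_multimap n A) s k g" and i: "i < s"
  shows "torus_proj (linear_lift n A r t) \<in> g i (torus_proj t) \<longleftrightarrow>
         torus_proj (linear_lift n A r t') \<in> g i (torus_proj t')"
proof -
  let ?C = "\<lambda>j. {t. torus_proj (linear_lift n A r t) \<in> g j (torus_proj t)}"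
  have closed: "closed (?C j)" if "j < s" for j
  proof -
    have "continuous_map torus (unordered_conf (k j) torus) (g j)"
      using part that by (simp add: partition_into_def multivalued_map_def)
    from continuous_map_compose[OF quotient_imp_continuous_map[OF quotient_map_torus_proj] this]
    have "multivalued_map (k j) euclidean torus (\<lambda>t. g j (torus_proj t))"
      by (simp add: multivalued_map_def o_def)
    from closedin_mem_multivalued_map[OF Hausdorff_space_torus continuous_map_torus_proj_lift this]
    show ?thesis by simp
  qed
  \<comment> \<open>Branch indices run over 1 to \<open>n\<close>, not 0 to \<open>n - 1\<close>, so
    an arbitrary \<open>r\<close> is reduced as \<open>(r - 1) mod int n + 1\<close>.\<close>
  have mem: "torus_proj (linear_lift n A r t) \<in> (\<Union>j<s. g j (torus_proj t))" for t
  proof -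
    have "(r - 1) mod int n + 1 \<in> {1..int n}"
      using n pos_mod_bound[of "int n" "r - 1"] pos_mod_sign[of "int n" "r - 1"]
      unfolding atLeastAtMost_iff by linarith
    moreover have "torus_proj (linear_lift n A r t) =
        torus_proj (linear_lift n A ((r - 1) mod int n + 1) t)"
      by (rule linear_lift_proj_mod[OF n]) (simp add: mod_simps)
    ultimately have "torus_proj (linear_lift n A r t) \<in> linear_multimap n A (torus_proj t)"
      unfolding linear_multimap_proj[OF n A] by blast
    then show ?thesis using part by (simp add: partition_into_def)
  qed
  \<comment> \<open>Branch \<open>r\<close> lies in exactly one member at each \<open>t\<close>, so
    the complement is a finite union of closed sets.\<close>
  have "- ?C i = (\<Union>j\<in>{..<s} - {i}. ?C j)"
    using mem partition_into_disjoint[OF part _ i] by fastforce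
  moreover have "closed (\<Union>j\<in>{..<s} - {i}. ?C j)"
    using closed by (intro closed_UN) auto
  ultimately have "open (?C i)"
    by (simp add: closed_def[symmetric] open_closed)
  then have "?C i = {} \<or> ?C i = UNIV"
    using closed[OF i] by (simp only: clopen[symmetric] simp_thms)
  then show ?thesis by blast
qed

section \<open>From a nontrivial partition to a common factor\<close>

lemma common_divisor_if_nontrivial_partition:
  fixes A :: "int^'q^'q"
  assumes n: "0 < n" and A: "\<And>i j. [A $ i $ j = l $ j] (mod int n)"
    and "has_nontrivial_partition n torus torus (linear_multimap n A)"
  shows "\<exists>m::int. 1 < m \<and> m dvd int n \<and> (\<forall>j. m dvd l $ j)"
proof -
  have A': "[A $ i $ j = A $ i' $ j] (mod int n)" for i i' j
    using A cong_sym cong_trans by blast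
  obtain s k g where s: "2 \<le> s"
    and part: "partition_into n torus torus (linear_multimap n A) s k g"
    using assms(3) by (auto simp: has_nontrivial_partition_def)
  \<comment> \<open>The residues selected by \<open>g 0\<close>, read off at the origin; by
    constancy any other \<open>t\<close> gives the same predicate.\<close>
  define Q where "Q r \<longleftrightarrow> torus_proj (linear_lift n A r 0) \<in> g 0 (torus_proj 0)" for r
  have Q: "Q r \<longleftrightarrow> torus_proj (linear_lift n A r t) \<in> g 0 (torus_proj t)" for r t
    unfolding Q_def using s by (intro partition_branch_constant[OF n A' part]) auto
  have mult: "multivalued_map (k i) torus torus (g i)" "0 < k i" if "i < s" for i
    using part that by (auto simp: partition_into_def)
  have ex: "\<exists>r. torus_proj (linear_lift n A r 0) \<in> g i (torus_proj 0)" if "i < s" for i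
  proof -
    have "g i (torus_proj 0) \<in> topspace (unordered_conf (k i) torus)"
      using mult(1)[OF that] by (auto simp: multivalued_map_def continuous_map_def)
    then have "g i (torus_proj 0) \<noteq> {}"
      using mult(2)[OF that] by (auto simp: topspace_unordered_conf)
    moreover have "g i (torus_proj 0) \<subseteq> linear_multimap n A (torus_proj 0)"
      using part that by (auto simp: partition_into_def)
    ultimately show ?thesis
      unfolding linear_multimap_proj[OF n A'] by blast
  qed
  obtain a where a: "Q a"
    using ex[of 0] s by (auto simp: Q_def)
  \<comment> \<open>As \<open>s\<close> is at least 2, there is a second member; its values are
    nonempty and disjoint from those of \<open>g 0\<close>.\<close>
  obtain b where "torus_proj (linear_lift n A b 0) \<in> g 1 (torus_proj 0)"
    using ex[of 1] s by auto
  then have b: "\<not> Q b"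
    using partition_into_disjoint[OF part, of "torus_proj 0" 0] s
    by (auto simp: Q_def disjoint_iff)
  have per: "Q (r + int n) \<longleftrightarrow> Q r" for r
    by (simp add: Q_def linear_lift_proj_mod[OF n, of "r + int n" r])
  obtain m where m: "1 < m" "\<And>d. (\<And>r. Q (r + d) \<longleftrightarrow> Q r) \<Longrightarrow> m dvd d"
    using common_period_divisor[of "int n" Q, OF _ per a b] n by auto
  \<comment> \<open>The unit vector and the origin are the same torus point, but branch
    \<open>r\<close> at the former is branch \<open>r + l $ j\<close> at the latter.\<close>
  have "Q (r + l $ j) \<longleftrightarrow> Q r" for r j
  proof -
    have "torus_proj (axis j 1) = torus_proj (0 :: real^'q)"
      by (auto simp: torus_proj_eq_iff axis_def)
    then show ?thesis
      using Q[of r "0 + axis j 1"] linear_lift_proj_add_axis[OF n A, of r 0 j]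
      by (simp add: Q_def)
  qed
  with m per show ?thesis by blast
qed

section \<open>From a common factor to a partition\<close>

lemma partition_of_common_divisor:
  fixes A :: "int^'q^'q"
  assumes m: "0 < m" and d: "0 < d"
    and A: "\<And>i i' j. [A $ i $ j = A $ i' $ j] (mod int (m * d))" "\<And>i j. int m dvd A $ i $ j"
  shows "\<exists>g. partition_into (m * d) torus torus (linear_multimap (m * d) A) m (\<lambda>_. d) g \<and>
           (\<forall>i<m. multivalued_homotopic d torus torus (g i)
              (linear_multimap d (map_matrix (\<lambda>a. a div int m) A)))"
proof -
  define B where "B = map_matrix (\<lambda>a. a div int m) A"
  have AB: "A $ i $ j = int m * B $ i $ j" for i j
    using A(2) by (simp add: B_def map_matrix_def)
  have B: "[B $ i $ j = B $ i' $ j] (mod int d)" for i i' j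
    using A(1)[of i j i'] m by (simp add: AB cong_iff_dvd_diff flip: right_diff_distrib)
  have md: "0 < m * d" using m d by simp
  \<comment> \<open>Since \<open>A\<close> is \<open>m\<close> times \<open>B\<close>, branch
    \<open>r\<close> of \<open>B\<close> is the lift of \<open>A\<close> with index
    \<open>m * r\<close>. The vector \<open>v i\<close> corrects this index to
    \<open>i + 1 + m * (r - 1)\<close>, and vanishes for \<open>i = m - 1\<close>.\<close>
  define v :: "nat \<Rightarrow> real^'q" where "v i = ((real i + 1 - real m) / real (m * d)) *\<^sub>R (\<chi> i. 1)" for i
  define g where "g i x = (`) (\<lambda>s. s + v i) ` linear_multimap d B x" for i x
  have hom: "multivalued_homotopic d torus torus (linear_multimap d B) (g i)" for i
    unfolding g_def by (rule multivalued_homotopic_translation[OF d B])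
  have lift: "linear_lift d B r t + v i = linear_lift (m * d) A (int i + 1 + int m * (r - 1)) t"
    for r t i
  proof (rule vec_eq_iff[THEN iffD2], rule allI)
    fix q
    have "(\<Sum>j\<in>UNIV. real_of_int (A $ q $ j) * t $ j) =
        real m * (\<Sum>j\<in>UNIV. real_of_int (B $ q $ j) * t $ j)"
      by (simp add: AB sum_distrib_left mult.assoc)
    then show "(linear_lift d B r t + v i) $ q =
        linear_lift (m * d) A (int i + 1 + int m * (r - 1)) t $ q"
      using m d by (simp add: linear_lift_nth v_def field_simps)
  qed
  \<comment> \<open>Division of \<open>k - 1\<close> by \<open>m\<close>: the remainder
    \<open>i\<close> names the member of the partition, the quotient \<open>r - 1\<close> the branch
    within it.\<close>
  have idx: "{1..int (m * d)} = (\<Union>i<m. (\<lambda>r. int i + 1 + int m * (r - 1)) ` {1..int d})"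
  proof (intro equalityI subsetI)
    fix k assume k: "k \<in> {1..int (m * d)}"
    define i where "i = nat ((k - 1) mod int m)"
    define r where "r = (k - 1) div int m + 1"
    have "i < m" "k = int i + 1 + int m * (r - 1)"
      using m by (simp_all add: i_def r_def nat_less_iff)
    moreover have "r \<in> {1..int d}"
    proof -
      have "(k - 1) div int m < int d"
      proof (rule mult_left_less_imp_less)
        have "int m * ((k - 1) div int m) \<le> k - 1"
          using m mult_div_mod_eq[of "int m" "k - 1"] pos_mod_sign[of "int m" "k - 1"] by linarith
        also have "\<dots> < int m * int d" using k by simp
        finally show "int m * ((k - 1) div int m) < int m * int d" .
      qed simp
      then show ?thesis using k m by (simp add: r_def pos_imp_zdiv_nonneg_iff)
    qed
    ultimately show "k \<in> (\<Union>i<m. (\<lambda>r. int i + 1 + int m * (r - 1)) ` {1..int d})" by blast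
  next
    fix k assume "k \<in> (\<Union>i<m. (\<lambda>r. int i + 1 + int m * (r - 1)) ` {1..int d})"
    then obtain i r where k: "i < m" "1 \<le> r" "r \<le> int d" "k = int i + 1 + int m * (r - 1)" by auto
    have "int m * (r - 1) \<le> int m * (int d - 1)" "0 \<le> int m * (r - 1)"
      using k by (auto intro: mult_left_mono)
    then show "k \<in> {1..int (m * d)}"
      unfolding k(4) atLeastAtMost_iff of_nat_mult right_diff_distrib mult_1_right
      using k(1) by linarith
  qed
  \<comment> \<open>Continuity comes for free, \<open>g i\<close> being an end of a
    homotopy.\<close>
  have "multivalued_map d torus torus (g i)" for i
    using homotopic_with_imp_continuous_maps[OF hom[unfolded multivalued_homotopic_def]]
    by (simp add: multivalued_map_def)
  moreover have "linear_multimap (m * d) A x = (\<Union>i<m. g i x)" if x: "x \<in> topspace torus" for x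
  proof -
    obtain t where "x = torus_proj t" using x by auto
    then show ?thesis
      by (simp only: g_def linear_multimap_proj[OF md A(1)] linear_multimap_proj[OF d B]
          idx image_UN image_image image_add_torus_proj lift)
  qed
  ultimately have "partition_into (m * d) torus torus (linear_multimap (m * d) A) m (\<lambda>_. d) g"
    using d multivalued_map_linear_multimap[OF md A(1)] by (simp add: partition_into_def)
  moreover have "multivalued_homotopic d torus torus (g i) (linear_multimap d B)" for i
    using hom[of i] unfolding multivalued_homotopic_def by (rule homotopic_with_symD)
  ultimately show ?thesis unfolding B_def by blast
qed

theorem theorem5p2:
  fixes n :: nat and A :: "int^'q^'q" and l :: "int^'q"
  assumes "0 < n"
    and "\<And>i j. [A $ i $ j = l $ j] (mod int n)"
  shows "(has_nontrivial_partition n torus torus (linear_multimap n A) \<longleftrightarrow>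
            (\<exists>m::int. 1 < m \<and> m dvd int n \<and> (\<forall>j. m dvd l $ j))) \<and>
         (\<forall>m::int. 1 < m \<and> m dvd int n \<and> (\<forall>j. m dvd l $ j) \<longrightarrow>
            (\<exists>k g. partition_into n torus torus (linear_multimap n A) (nat m) k g \<and>
               (\<forall>i<nat m. k i = n div nat m \<and>
                  multivalued_homotopic (n div nat m) torus torus (g i)
                    (linear_multimap (n div nat m) (map_matrix (\<lambda>a. a div m) A)))))"
proof -
  have A: "[A $ i $ j = A $ i' $ j] (mod int n)" for i i' j
    using assms(2) cong_sym cong_trans by blast
  have part: "\<exists>k g. partition_into n torus torus (linear_multimap n A) (nat m) k g \<and>
               (\<forall>i<nat m. k i = n div nat m \<and>
                  multivalued_homotopic (n div nat m) torus torus (g i)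
                    (linear_multimap (n div nat m) (map_matrix (\<lambda>a. a div m) A)))"
    if m: "1 < m" "m dvd int n" "\<forall>j. m dvd l $ j" for m :: int
  proof -
    have "nat m dvd n"
      using m by (simp add: nat_dvd_iff)
    then have n: "n = nat m * (n div nat m)" by simp
    then have "0 < n div nat m" using assms(1) by (metis gr0I mult_0_right)
    \<comment> \<open>\<open>m\<close> divides \<open>l $ j\<close> and, through \<open>n\<close>,
      also the difference between \<open>A $ i $ j\<close> and \<open>l $ j\<close>.\<close>
    moreover have "int (nat m) dvd A $ i $ j" for i j
    proof -
      have "m dvd A $ i $ j - l $ j"
        using assms(2)[of i j] m(2) by (auto simp: cong_iff_dvd_diff)
      then show ?thesis using m by (simp add: dvd_diff_left_iff)
    qed
    ultimately show ?thesis
      using partition_of_common_divisor[of "nat m" "n div nat m" A] A m(1)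
      by (intro exI[of _ "\<lambda>_. n div nat m"]) (simp flip: n)
  qed
  have "has_nontrivial_partition n torus torus (linear_multimap n A)"
    if m: "1 < m" "m dvd int n" "\<forall>j. m dvd l $ j" for m :: int
    using part[OF m] m(1) unfolding has_nontrivial_partition_def
    by (intro exI[of _ "nat m"]) auto
  with part common_divisor_if_nontrivial_partition[OF assms] show ?thesis by blast
qed

end
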